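(* Suppose $m\equiv 3 \pmod 6$ is a positive integer, $Q$ is a prime power such that $Q\ge m+1$, and $n$ is an integer with $2m/3\le n\le m(m-1)/6$. Then there exists a $(2,n,3)$-RTS with restricted repairability, with shares from $(\mathbb{F}_Q)^3$, having information rate $2/3$ and communication complexity $3/2$.
   Context: Threshold schemes. For $2\le k\le n$, a $(k,n)$-threshold scheme is a (randomized) method by which a dealer chooses a secret from a finite set $\mathcal{K}$ and gives a share, from a finite set $\mathcal{S}$ of possible shares, to each of $n$ players $P_1,\dots,P_n$, such that any $k$ players can compute the secret from their shares, and no $k-1$ players obtain any information about the secret (unconditionally: the distribution of their shares does not depend on the secret). Its information rate is $\log_2|\mathcal{K}|/\log_2|\mathcal{S}|$. Repairing. A repairing protocol lets a player $P_\ell$ who lost their share recover exactly that share, without the dealer, with help from a set of $d$ other players (not all of whom need actually send anything; $d$ is the repairing degree), over secure pairwise channels. It has two phases. In the message exchange phase (possibly empty) each of the $d$ players, using their own share and private randomness, simultaneously sends at most one message to each other member of the set. In the repairing phase the $d$ players each send a message to $P_\ell$ (depending on their share, randomness and the messages received), from which $P_\ell$ computes the lost share. Security: all players follow the protocol honestly, and for every coalition of $k-1$ players (which may or may not include $P_\ell$), the shares of the coalition together with all messages its members sent or received in the execution of the protocol give no information about the secret. A $(k,n)$-threshold scheme with such a secure protocol with repairing degree $d$ is a $(k,n,d)$-RTS (repairable threshold scheme). It has restricted repairability if for every player there exists a set of $d$ other players who can repair that player's share. The communication complexity of a repairing protocol is the sum of the bit-lengths of all messages transmitted divided by the bit-length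 of the secret (an element of a set of size $N$ has bit-length $\log_2 N$). *)

theory Defs
  imports "HOL-Probability.Product_PMF" "HOL-Number_Theory.Prime_Powers" "HOL-Algebra.Ring"
begin

text \<open>
  Players are the numbers \<open>1, \<dots>, n\<close>.  The dealer is a map \<open>D\<close> sending a secret to the joint
  distribution of the shares, \<open>\<sigma> i\<close> being the share of player \<open>i\<close>.  That some players obtain no
  information about the secret means that the distribution of what they see is the same for all
  secrets, so no prior distribution on the secrets is needed.
\<close>

definition threshold_scheme ::
  "nat \<Rightarrow> nat \<Rightarrow> 'k set \<Rightarrow> 's set \<Rightarrow> ('k \<Rightarrow> (nat \<Rightarrow> 's) pmf) \<Rightarrow> bool" where
  "threshold_scheme k n K S D \<longleftrightarrow>
     2 \<le> k \<and> k \<le> n \<and> finite K \<and> K \<noteq> {} \<and> finite S \<and>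
     (\<forall>\<kappa>\<in>K. \<forall>\<sigma>\<in>set_pmf (D \<kappa>). \<forall>i\<in>{1..n}. \<sigma> i \<in> S) \<and>
     (\<forall>A. A \<subseteq> {1..n} \<and> card A = k \<longrightarrow>
        (\<exists>reconstruct. \<forall>\<kappa>\<in>K. \<forall>\<sigma>\<in>set_pmf (D \<kappa>). reconstruct (restrict \<sigma> A) = \<kappa>)) \<and>
     (\<forall>A. A \<subseteq> {1..n} \<and> card A = k - 1 \<longrightarrow>
        (\<forall>\<kappa>\<in>K. \<forall>\<kappa>'\<in>K.
           map_pmf (\<lambda>\<sigma>. restrict \<sigma> A) (D \<kappa>) = map_pmf (\<lambda>\<sigma>. restrict \<sigma> A) (D \<kappa>')))"

definition information_rate :: "'k set \<Rightarrow> 's set \<Rightarrow> real" where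
  "information_rate K S = log 2 (real (card K)) / log 2 (real (card S))"

text \<open>
  A repairing protocol for one lost share.  \<open>exchange_msg P i j\<close> computes, from the share and the
  private randomness of helper \<open>i\<close>, the message of \<open>i\<close> to \<open>j\<close> in the message exchange phase;
  \<open>repair_msg P i\<close> computes the message of \<open>i\<close> to the repaired player from the share, the randomness
  and the exchange messages received by \<open>i\<close> (indexed by their senders).  The value \<open>None\<close> means that
  no message is sent.  \<open>recover P\<close> is applied to the family of repair messages.
\<close>

record ('s, 'm, 'r) repair_protocol =
  randomness :: "nat \<Rightarrow> 'r pmf"
  exchange_msg :: "nat \<Rightarrow> nat \<Rightarrow> 's \<Rightarrow> 'r \<Rightarrow> 'm option"
  repair_msg :: "nat \<Rightarrow> 's \<Rightarrow> 'r \<Rightarrow> (nat \<Rightarrow> 'm option) \<Rightarrow> 'm option"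
  recover :: "(nat \<Rightarrow> 'm option) \<Rightarrow> 's"

text \<open>In the following, \<open>H\<close> is the set of helpers, \<open>\<sigma>\<close> the shares and \<open>\<rho>\<close> the helpers' randomness.\<close>

definition exchange_sent ::
  "nat set \<Rightarrow> ('s, 'm, 'r) repair_protocol \<Rightarrow> (nat \<Rightarrow> 's) \<Rightarrow> (nat \<Rightarrow> 'r) \<Rightarrow> nat \<Rightarrow> nat \<Rightarrow> 'm option" where
  "exchange_sent H P \<sigma> \<rho> i j =
     (if i \<in> H \<and> j \<in> H \<and> i \<noteq> j then exchange_msg P i j (\<sigma> i) (\<rho> i) else None)"

definition repair_sent ::
  "nat set \<Rightarrow> ('s, 'm, 'r) repair_protocol \<Rightarrow> (nat \<Rightarrow> 's) \<Rightarrow> (nat \<Rightarrow> 'r) \<Rightarrow> nat \<Rightarrow> 'm option" where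
  "repair_sent H P \<sigma> \<rho> i =
     (if i \<in> H then repair_msg P i (\<sigma> i) (\<rho> i) (\<lambda>j. exchange_sent H P \<sigma> \<rho> j i) else None)"

text \<open>The helpers' randomness is independent of the shares and between helpers.\<close>

definition execution ::
  "nat set \<Rightarrow> ('s, 'm, 'r) repair_protocol \<Rightarrow> (nat \<Rightarrow> 's) pmf \<Rightarrow> ((nat \<Rightarrow> 's) \<times> (nat \<Rightarrow> 'r)) pmf" where
  "execution H P shares = pair_pmf shares (Pi_pmf H undefined (randomness P))"

text \<open>
  What a coalition \<open>C\<close> sees when the share of player \<open>l\<close> is repaired: its shares, the exchange
  messages with sender or receiver in \<open>C\<close>, and the repair messages with sender in \<open>C\<close> (all repair
  messages if \<open>l \<in> C\<close>, since \<open>l\<close> is their receiver).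
\<close>

definition coalition_view ::
  "nat \<Rightarrow> nat set \<Rightarrow> ('s, 'm, 'r) repair_protocol \<Rightarrow> nat set \<Rightarrow> (nat \<Rightarrow> 's) \<times> (nat \<Rightarrow> 'r) \<Rightarrow>
     (nat \<Rightarrow> 's) \<times> (nat \<Rightarrow> nat \<Rightarrow> 'm option) \<times> (nat \<Rightarrow> 'm option)" where
  "coalition_view l H P C = (\<lambda>(\<sigma>, \<rho>).
     (restrict \<sigma> C,
      \<lambda>i j. if i \<in> C \<or> j \<in> C then exchange_sent H P \<sigma> \<rho> i j else None,
      \<lambda>i. if i \<in> C \<or> l \<in> C then repair_sent H P \<sigma> \<rho> i else None))"

definition executions ::
  "'k set \<Rightarrow> ('k \<Rightarrow> (nat \<Rightarrow> 's) pmf) \<Rightarrow> nat set \<Rightarrow> ('s, 'm, 'r) repair_protocol \<Rightarrow>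
     ((nat \<Rightarrow> 's) \<times> (nat \<Rightarrow> 'r)) set" where
  "executions K D H P = (\<Union>\<kappa>\<in>K. set_pmf (execution H P (D \<kappa>)))"

text \<open>
  The bit-length of a message is measured in the set of values it actually takes over all
  executions, so it cannot be inflated by an oversized alphabet.  A missing message counts as a
  value; hence a channel that is never used contributes \<open>log 2 1 = 0\<close>.
\<close>

definition exchange_values ::
  "'k set \<Rightarrow> ('k \<Rightarrow> (nat \<Rightarrow> 's) pmf) \<Rightarrow> nat set \<Rightarrow> ('s, 'm, 'r) repair_protocol \<Rightarrow>
     nat \<Rightarrow> nat \<Rightarrow> 'm option set" where
  "exchange_values K D H P i j = (\<lambda>(\<sigma>, \<rho>). exchange_sent H P \<sigma> \<rho> i j) ` executions K D H P"

definition repair_values ::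
  "'k set \<Rightarrow> ('k \<Rightarrow> (nat \<Rightarrow> 's) pmf) \<Rightarrow> nat set \<Rightarrow> ('s, 'm, 'r) repair_protocol \<Rightarrow>
     nat \<Rightarrow> 'm option set" where
  "repair_values K D H P i = (\<lambda>(\<sigma>, \<rho>). repair_sent H P \<sigma> \<rho> i) ` executions K D H P"

definition communication_complexity ::
  "'k set \<Rightarrow> ('k \<Rightarrow> (nat \<Rightarrow> 's) pmf) \<Rightarrow> nat set \<Rightarrow> ('s, 'm, 'r) repair_protocol \<Rightarrow> real" where
  "communication_complexity K D H P =
     ((\<Sum>i\<in>H. \<Sum>j\<in>H - {i}. log 2 (real (card (exchange_values K D H P i j)))) +
      (\<Sum>i\<in>H. log 2 (real (card (repair_values K D H P i))))) / log 2 (real (card K))"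

definition secure_repairing_protocol ::
  "nat \<Rightarrow> nat \<Rightarrow> 'k set \<Rightarrow> ('k \<Rightarrow> (nat \<Rightarrow> 's) pmf) \<Rightarrow> nat \<Rightarrow> nat set \<Rightarrow>
     ('s, 'm, 'r) repair_protocol \<Rightarrow> bool" where
  "secure_repairing_protocol k n K D l H P \<longleftrightarrow>
     (\<forall>i\<in>H. \<forall>j\<in>H - {i}. finite (exchange_values K D H P i j)) \<and>
     (\<forall>i\<in>H. finite (repair_values K D H P i)) \<and>
     (\<forall>(\<sigma>, \<rho>)\<in>executions K D H P. recover P (repair_sent H P \<sigma> \<rho>) = \<sigma> l) \<and>
     (\<forall>C. C \<subseteq> {1..n} \<and> card C = k - 1 \<longrightarrow>
        (\<forall>\<kappa>\<in>K. \<forall>\<kappa>'\<in>K.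
           map_pmf (coalition_view l H P C) (execution H P (D \<kappa>)) =
           map_pmf (coalition_view l H P C) (execution H P (D \<kappa>'))))"

text \<open>
  A \<open>(k, n, d)\<close>-RTS with restricted repairability, together with the helper sets \<open>H l\<close> and the
  repairing protocols \<open>P l\<close> for the players \<open>l\<close>.
\<close>

definition restricted_rts ::
  "nat \<Rightarrow> nat \<Rightarrow> nat \<Rightarrow> 'k set \<Rightarrow> 's set \<Rightarrow> ('k \<Rightarrow> (nat \<Rightarrow> 's) pmf) \<Rightarrow> (nat \<Rightarrow> nat set) \<Rightarrow>
     (nat \<Rightarrow> ('s, 'm, 'r) repair_protocol) \<Rightarrow> bool" where
  "restricted_rts k n d K S D H P \<longleftrightarrow>
     threshold_scheme k n K S D \<and>
     (\<forall>l\<in>{1..n}. H l \<subseteq> {1..n} - {l} \<and> card (H l) = d \<and>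
        secure_repairing_protocol k n K D l (H l) (P l))"

end

theory Submission
  imports Defs "HOL-Algebra.Polynomial_Divisibility"
begin

text \<open>
  Let the players be the blocks of a partial triple system on \<open>m\<close> points of \<open>F\<close> in which every point
  lies on at least two blocks.  The dealer chooses a polynomial of degree at most \<open>4\<close> whose two
  top coefficients are the secret, and a player's share consists of its values at the three points
  of the block.  Two blocks meet in at most one point, so two players know five values and hence the
  polynomial, whereas three values are uniformly distributed whatever the top coefficients are.  A
  share is repaired by asking, for each of its three points, another player on that point for the
  value there.

  No Kirkman triple system is needed to find such a triple system with exactly \<open>n\<close> blocks: for
  \<open>n \<ge> m\<close> take \<open>n\<close> blocks of the Steiner triple system of Bose, including a set of \<open>m\<close> blocks which
  covers every point three times; for \<open>n < m\<close> take \<open>n\<close> blocks of a transversal design with groups of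
  size \<open>m / 3\<close>, including two parallel classes.
\<close>

section \<open>Triple systems\<close>

definition partial_triple_system :: "'a set \<Rightarrow> 'a set set \<Rightarrow> bool" where
  "partial_triple_system V \<B> \<longleftrightarrow>
     \<B> \<subseteq> {b. b \<subseteq> V \<and> card b = 3} \<and> pairwise (\<lambda>b b'. card (b \<inter> b') \<le> 1) \<B>"

text \<open>With two blocks through every point, the loss of one share leaves another player who
  knows the value at that point.\<close>

definition doubly_covering :: "'a set \<Rightarrow> 'a set set \<Rightarrow> bool" where
  "doubly_covering V \<B> \<longleftrightarrow> (\<forall>x\<in>V. \<exists>b\<in>\<B>. \<exists>b'\<in>\<B>. b \<noteq> b' \<and> x \<in> b \<and> x \<in> b')"

text \<open>Both constructions below index their blocks, and one check on indices gives both
  conclusions: distinct blocks cannot share two points, whereas equal blocks do so because they have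
  three. Injectivity turns counting indices into counting blocks.\<close>

lemma partial_triple_system_family:
  assumes "\<And>i. i \<in> I \<Longrightarrow> blk i \<subseteq> V \<and> card (blk i) = 3"
    and "\<And>i i' p q. i \<in> I \<Longrightarrow> i' \<in> I \<Longrightarrow> p \<noteq> q \<Longrightarrow> p \<in> blk i \<Longrightarrow> q \<in> blk i \<Longrightarrow>
           p \<in> blk i' \<Longrightarrow> q \<in> blk i' \<Longrightarrow> i = i'"
  shows "partial_triple_system V (blk ` I)" and "inj_on blk I"
proof -
  show "partial_triple_system V (blk ` I)"
    unfolding partial_triple_system_def
  proof (intro conjI pairwiseI)
    show "blk ` I \<subseteq> {b. b \<subseteq> V \<and> card b = 3}" using assms(1) by auto
  next
    fix b b' assume b: "b \<in> blk ` I" "b' \<in> blk ` I" "b \<noteq> b'"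
    then have "finite b" using assms(1) by (metis card.infinite imageE zero_neq_numeral)
    moreover have "p = q" if "p \<in> b \<inter> b'" "q \<in> b \<inter> b'" for p q
      using b that assms(2)[of _ _ p q] by (metis IntE imageE)
    ultimately have "card (b \<inter> b') \<le> Suc 0"
      by (subst card_le_Suc0_iff_eq) auto
    then show "card (b \<inter> b') \<le> 1" by simp
  qed
  show "inj_on blk I"
  proof (rule inj_onI)
    fix i i' assume i: "i \<in> I" "i' \<in> I" "blk i = blk i'"
    then have "card (blk i) = 3" using assms(1) by blast
    then obtain p q r where "blk i = {p, q, r}" "p \<noteq> q"
      by (auto simp: card_3_iff)
    then show "i = i'" using assms(2)[of i i' p q] i by auto
  qed
qed

text \<open>Small intersections pass to subfamilies and covering passes to larger families, so every
  family between \<open>\<D>\<close> and \<open>\<B>\<close> has both properties, and its size can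
  be chosen freely in that range.\<close>

lemma doubly_covering_subsystem:
  assumes pts: "partial_triple_system V \<B>" and fin: "finite \<B>"
    and \<D>: "\<D> \<subseteq> \<B>" "doubly_covering V \<D>" "card \<D> \<le> n" and n: "n \<le> card \<B>"
  obtains \<C> where "partial_triple_system V \<C>" "doubly_covering V \<C>" "finite \<C>" "card \<C> = n"
proof -
  obtain \<C> where \<C>: "\<D> \<subseteq> \<C>" "\<C> \<subseteq> \<B>" "card \<C> = n"
    using exists_subset_between[OF \<D>(3) n \<D>(1) fin] by blast
  have "partial_triple_system V \<C>"
    using pts \<C>(2) pairwise_subset[of _ \<B> \<C>] unfolding partial_triple_system_def by blast
  moreover have "doubly_covering V \<C>"
    using \<D>(2) \<C>(1) unfolding doubly_covering_def by (meson subsetD)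
  ultimately show ?thesis
    using that \<C> fin finite_subset by blast
qed

lemma partial_triple_system_image:
  assumes "inj_on g V" "partial_triple_system V \<C>"
  shows "partial_triple_system (g ` V) (image g ` \<C>)"
  unfolding partial_triple_system_def
proof (intro conjI pairwiseI)
  have sub: "b \<subseteq> V \<and> card b = 3" if "b \<in> \<C>" for b using that assms(2) by (auto simp: partial_triple_system_def)
  show "image g ` \<C> \<subseteq> {b. b \<subseteq> g ` V \<and> card b = 3}"
    using sub inj_on_subset[OF assms(1)] by (auto simp: card_image)
  fix b b' assume "b \<in> image g ` \<C>" "b' \<in> image g ` \<C>" "b \<noteq> b'"
  then obtain a a' where a: "b = g ` a" "b' = g ` a'" "a \<in> \<C>" "a' \<in> \<C>" "a \<noteq> a'" by blast
  then have "card (a \<inter> a') \<le> 1" using assms(2) by (auto simp: partial_triple_system_def pairwise_def)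
  moreover have "b \<inter> b' = g ` (a \<inter> a')"
    using a sub inj_on_image_Int[OF assms(1)] by metis
  moreover have "card (g ` (a \<inter> a')) = card (a \<inter> a')"
    using a sub by (intro card_image inj_on_subset[OF assms(1)]) auto
  ultimately show "card (b \<inter> b') \<le> 1" by simp
qed

lemma doubly_covering_image:
  assumes "inj_on g V" "\<C> \<subseteq> Pow V" "doubly_covering V \<C>"
  shows "doubly_covering (g ` V) (image g ` \<C>)"
  unfolding doubly_covering_def
proof
  fix y assume "y \<in> g ` V"
  then obtain x where x: "x \<in> V" "y = g x" by blast
  then obtain b b' where b: "b \<in> \<C>" "b' \<in> \<C>" "b \<noteq> b'" "x \<in> b" "x \<in> b'"
    using assms(3) unfolding doubly_covering_def by blast
  then have "g ` b \<noteq> g ` b'" using inj_on_image_eq_iff[OF assms(1)] assms(2) by (metis PowD subsetD)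
  then show "\<exists>b\<in>image g ` \<C>. \<exists>b'\<in>image g ` \<C>. b \<noteq> b' \<and> y \<in> b \<and> y \<in> b'"
    using b x by (meson imageI)
qed

section \<open>Transversal designs on three levels of residues\<close>

definition triple_points :: "int \<Rightarrow> (int \<times> nat) set" where
  "triple_points v = {0..<v} \<times> {0, 1, 2}"

lemma card_triple_points: "card (triple_points v) = 3 * nat v"
  by (simp add: triple_points_def card_cartesian_product)

lemma dvd_double_odd:
  fixes v k :: int
  assumes "odd v" "v dvd 2 * k" shows "v dvd k"
  using assms coprime_dvd_mult_right_iff[of v 2 k] by (simp add: coprime_commute)

lemma eq_if_dvd_diff:
  fixes v x y :: int
  assumes "v dvd x - y" "x \<in> {0..<v}" "y \<in> {0..<v}" shows "x = y"
  using assms by (metis atLeastLessThan_iff mod_eq_dvd_iff mod_pos_pos_trivial)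

text \<open>The terms x - d, x, x + d of an arithmetic progression modulo v are placed on the levels
  0, 1, 2. For odd v these are the v^2 blocks of a transversal design whose groups are the
  levels.\<close>

definition td_block :: "int \<Rightarrow> int \<times> int \<Rightarrow> (int \<times> nat) set" where
  "td_block v = (\<lambda>(x, d). (\<lambda>i. ((x + (int i - 1) * d) mod v, i)) ` {0, 1, 2})"

text \<open>Two points of a block lie on different levels. Their levels differ by 1 or 2 up to sign,
  which is invertible modulo the odd number v, so the residues give d and then x. The blocks with a
  fixed d form a parallel class, and the 2 v blocks with d = 0 or d = 1 cover every point
  twice.\<close>

lemma td_blocks:
  fixes t :: int
  defines "v \<equiv> 2 * t + 1"
  assumes t: "t \<ge> 1" and n: "2 * nat v \<le> n" "n \<le> nat v * nat v"
  obtains \<C> where "partial_triple_system (triple_points v) \<C>" "doubly_covering (triple_points v) \<C>"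
    "finite \<C>" "card \<C> = n"
proof -
  define I where "I = {0..<v} \<times> {0..<v}"
  define J where "J = {0..<v} \<times> {0, 1::int}"
  have v: "v > 0" "v \<ge> 3" using t by (auto simp: v_def)
  have sub: "td_block v i \<subseteq> triple_points v \<and> card (td_block v i) = 3" if "i \<in> I" for i
    using that v by (auto simp: td_block_def I_def triple_points_def)
  have inter: "i = i'"
    if "i \<in> I" "i' \<in> I" "p \<noteq> q" "p \<in> td_block v i" "q \<in> td_block v i"
      "p \<in> td_block v i'" "q \<in> td_block v i'" for i i' p q
  proof -
    obtain x d x' d' where ii: "i = (x, d)" "i' = (x', d')" by (cases i; cases i')
    have lev: "snd r \<in> {0,1,2} \<and> fst r = (x + (int (snd r) - 1) * d) mod v"
      if "r \<in> td_block v (x, d)" for r x d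
      using that by (auto simp: td_block_def)
    have dvd: "v dvd (x - x') + (int (snd r) - 1) * (d - d')"
      if "r \<in> td_block v (x, d)" "r \<in> td_block v (x', d')" for r
    proof -
      have "(x + (int (snd r) - 1) * d) mod v = (x' + (int (snd r) - 1) * d') mod v"
        using lev[OF that(1)] lev[OF that(2)] by simp
      then show ?thesis by (simp add: mod_eq_dvd_iff algebra_simps)
    qed
    have "snd p \<noteq> snd q"
      using lev[of p x d] lev[of q x d] that ii by (auto simp: prod_eq_iff)
    moreover have "v dvd (int (snd p) - int (snd q)) * (d - d')"
      using dvd_diff[OF dvd[of p] dvd[of q]] that ii by (simp add: algebra_simps)
    ultimately have "v dvd (d - d') \<or> v dvd - (d - d') \<or> v dvd 2 * (d - d') \<or> v dvd - (2 * (d - d'))"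
      using lev[of p x d] lev[of q x d] that ii by auto
    then have "v dvd d - d'"
      using dvd_double_odd[of v "d - d'"] v_def
      by (metis dvd_minus_iff even_mult_iff even_plus_one_iff even_numeral)
    then have "d = d'" using that ii by (auto simp: I_def intro: eq_if_dvd_diff)
    moreover from this have "x = x'" using dvd[of p] that ii by (auto simp: I_def intro: eq_if_dvd_diff)
    ultimately show ?thesis using ii by simp
  qed
  have fam: "partial_triple_system (triple_points v) (td_block v ` I)" "inj_on (td_block v) I"
    using partial_triple_system_family[of I "td_block v" "triple_points v"] sub inter by metis+
  have JI: "J \<subseteq> I" using v by (auto simp: J_def I_def)
  have cJ: "card (td_block v ` J) \<le> n"
  proof -
    have "card J = 2 * nat v" unfolding J_def card_cartesian_product by simp
    then show ?thesis using n card_image[OF inj_on_subset[OF fam(2) JI]] by simp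
  qed
  have cI: "n \<le> card (td_block v ` I)"
    using n by (subst card_image[OF fam(2)]) (auto simp: I_def card_cartesian_product)
  have cover: "doubly_covering (triple_points v) (td_block v ` J)"
    unfolding doubly_covering_def
  proof
    fix p assume "p \<in> triple_points v"
    then obtain x i where p: "p = (x, i)" "0 \<le> x" "x < v" "i \<in> {0, 1, 2}" by (auto simp: triple_points_def)
    \<comment> \<open>This is the middle term of the progression with difference 1 that passes
      through (x, i).\<close>
    define y where "y = (x + 1 - int i) mod v"
    have y: "0 \<le> y" "y < v" using v by (auto simp: y_def)
    have "p \<in> td_block v (x, 0)" "p \<in> td_block v (y, 1)"
      using p v by (auto simp: td_block_def y_def mod_simps)
    moreover have "(x, 0) \<in> J" "(y, 1) \<in> J" using p y by (auto simp: J_def)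
    moreover from this have "td_block v (x, 0) \<noteq> td_block v (y, 1)"
      using JI inj_onD[OF fam(2), of "(x, 0)" "(y, 1)"] by auto
    ultimately show "\<exists>b\<in>td_block v ` J. \<exists>b'\<in>td_block v ` J. b \<noteq> b' \<and> p \<in> b \<and> p \<in> b'"
      by blast
  qed
  show ?thesis
    using doubly_covering_subsystem[OF fam(1) _ image_mono[OF JI] cover cJ cI] that I_def by blast
qed

section \<open>Bose's Steiner triple systems\<close>

text \<open>
  In Bose's construction a block consists of two points of one level and their midpoint on the next
  level, or it is a column, which is indexed by \<open>d = 0\<close>, \<open>i = 0\<close>.  As \<open>d\<close> and \<open>- d\<close> give the same
  block, only \<open>0 \<le> d \<le> (v - 1) / 2\<close> is used.
\<close>

definition bose_block :: "int \<Rightarrow> int \<times> int \<times> nat \<Rightarrow> (int \<times> nat) set" where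
  "bose_block v = (\<lambda>(a, d, i).
     if d = 0 then {a} \<times> {0, 1, 2}
     else {((a - d) mod v, i), ((a + d) mod v, i), (a, (i + 1) mod 3)})"

text \<open>The position of two common points reveals the kind of block: equal residues mean a
  column, equal levels mean two ends, and otherwise one point is the midpoint and the other an end.
  As v is odd, two ends give their midpoint and d up to sign; an end and the midpoint also give d up
  to sign. The bound d \<le> t = (v - 1) / 2 settles the sign.\<close>

lemma bose_block_inter:
  fixes t a d a' d' :: int
  defines "v \<equiv> 2 * t + 1"
  assumes a: "0 \<le> a" "a < v" and d: "0 \<le> d" "d \<le> t" and i: "i \<in> {0, 1, 2}" "d = 0 \<longrightarrow> i = 0"
    and a': "0 \<le> a'" "a' < v" and d': "0 \<le> d'" "d' \<le> t" and i': "i' \<in> {0, 1, 2}" "d' = 0 \<longrightarrow> i' = 0"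
    and pq: "p \<noteq> q" "p \<in> bose_block v (a, d, i)" "q \<in> bose_block v (a, d, i)"
      "p \<in> bose_block v (a', d', i')" "q \<in> bose_block v (a', d', i')"
  shows "(a, d, i) = (a', d', i')"
proof -
  have half: "v dvd k" if "v dvd 2 * k" for k
    using dvd_double_odd[OF _ that] v_def by simp
  have no: "\<not> v dvd e" if "e \<noteq> 0" "\<bar>e\<bar> < v" for e
    using that zdvd_not_zless[of "\<bar>e\<bar>" v] by (auto simp: abs_if split: if_splits)
  \<comment> \<open>\<open>q\<close> is the midpoint and \<open>p\<close> one of the two points on the level below it\<close>
  define R where "R = (\<lambda>(p :: int \<times> nat) q a d i.
    (\<exists>e. (e = d \<or> e = - d) \<and> v dvd fst p - a - e \<and> fst q = a) \<and>
    d > 0 \<and> snd p = i \<and> snd q = (i + 1) mod 3)"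
  \<comment> \<open>This is stated for arbitrary parameters so that it applies to both blocks. The
    three cases are told apart by p and q alone, hence both blocks fall into the same one.\<close>
  have det: "(fst p = fst q \<and> d = 0 \<and> a = fst p \<and> i = 0) \<or>
      (fst p \<noteq> fst q \<and> snd p = snd q \<and> d > 0 \<and> i = snd p \<and> v dvd fst p + fst q - 2 * a \<and>
         (v dvd fst p - fst q - 2 * d \<or> v dvd fst p - fst q + 2 * d)) \<or>
      (fst p \<noteq> fst q \<and> snd p \<noteq> snd q \<and> (R p q a d i \<or> R q p a d i))"
    if a: "0 \<le> a" "a < v" and d: "0 \<le> d" "d \<le> t" and i: "i \<in> {0, 1, 2}" "d = 0 \<longrightarrow> i = 0"
      and pq: "p \<noteq> q" "p \<in> bose_block v (a, d, i)" "q \<in> bose_block v (a, d, i)"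
    for a d i p q
  proof (cases "d = 0")
    case True
    then show ?thesis using pq i by (auto simp: bose_block_def)
  next
    case False
    then have d0: "d > 0" "(i + 1) mod 3 \<noteq> i" using d i by auto
    define P where "P = (a - d) mod v"
    define S where "S = (a + d) mod v"
    have "v dvd (a - d) mod v - (a - d)" "v dvd (a + d) mod v - (a + d)"
      by (simp_all flip: mod_eq_dvd_iff)
    then have dv: "v dvd P - a - (- d)" "v dvd S - a - d" by (simp_all add: algebra_simps P_def S_def)
    have sum: "v dvd P + S - 2 * a" "v dvd S - P - 2 * d"
      using dvd_add[OF dv] dvd_diff[OF dv(2) dv(1)] by (simp_all add: algebra_simps)
    have diff: "v dvd P - S + 2 * d"
      using sum(2) dvd_minus_iff[of v "S - P - 2 * d"] by (simp add: algebra_simps)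
    have ne: "P \<noteq> S" "P \<noteq> a" "S \<noteq> a"
      using sum(2) half[of "-d"] dv no[of d] no[of "-d"] d0 d v_def by auto
    have blk: "bose_block v (a, d, i) = {(P, i), (S, i), (a, (i + 1) mod 3)}"
      using False by (simp add: bose_block_def P_def S_def)
    have RR: "R (P, i) (a, (i + 1) mod 3) a d i" "R (S, i) (a, (i + 1) mod 3) a d i"
      using dv d0 by (auto simp: R_def)
    consider "p = (P, i)" "q = (S, i)" | "p = (S, i)" "q = (P, i)"
      | "p \<in> {(P, i), (S, i)}" "q = (a, (i + 1) mod 3)" | "q \<in> {(P, i), (S, i)}" "p = (a, (i + 1) mod 3)"
      using pq unfolding blk by blast
    then show ?thesis
    proof cases
      case 1
      then show ?thesis using sum diff ne d0 by simp
    next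
      case 2
      then show ?thesis using sum diff ne d0 by (simp add: add.commute)
    next
      case 3
      then have "R p q a d i" "fst p \<noteq> fst q" "snd p \<noteq> snd q" using RR ne d0(2) by auto
      then show ?thesis by blast
    next
      case 4
      then have "R q p a d i" "fst p \<noteq> fst q" "snd p \<noteq> snd q" using RR ne d0(2) by auto
      then show ?thesis by blast
    qed
  qed
  have R_unique: "a = a' \<and> d = d' \<and> i = i'"
    if "R p q a d i" "R p q a' d' i'" "0 \<le> d" "d \<le> t" "0 \<le> d'" "d' \<le> t"
    for p q a d i a' d' i'
  proof -
    from that(1) obtain e where e: "e = d \<or> e = - d" "v dvd fst p - a - e" "fst q = a" "d > 0" "i = snd p"
      unfolding R_def by blast
    from that(2) obtain e' where e': "e' = d' \<or> e' = - d'" "v dvd fst p - a' - e'" "fst q = a'" "d' > 0" "i' = snd p"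
      unfolding R_def by blast
    \<comment> \<open>The signed offsets of p from the common midpoint are congruent, and they
      differ by at most 2 t < v.\<close>
    have "v dvd e' - e" using dvd_diff[OF e(2) e'(2)] e(3) e'(3) by simp
    moreover have "\<bar>e' - e\<bar> < v" using e(1) e'(1) that(3-6) v_def by auto
    ultimately have "e' - e = 0" using no by blast
    then show ?thesis using e(1,3-5) e'(1,3-5) by auto
  qed
  \<comment> \<open>Among three cyclically ordered levels no two follow each other both ways, so end
    and midpoint cannot swap roles.\<close>
  have R_asym: False if "R p q a d i" "R q p a' d' i'" "i \<in> {0, 1, 2}" "i' \<in> {0, 1, 2}" for p q a d i a' d' i'
    using that by (auto simp: R_def)
  have mid: "a = a' \<and> d = d'"
    if mid: "v dvd x + y - 2 * a" "v dvd x - y - 2 * d \<or> v dvd x - y + 2 * d"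
      "v dvd x + y - 2 * a'" "v dvd x - y - 2 * d' \<or> v dvd x - y + 2 * d'"
      "0 \<le> a" "a < v" "0 \<le> a'" "a' < v" "0 < d" "d \<le> t" "0 < d'" "d' \<le> t"
    for x y a d a' d'
  proof -
    \<comment> \<open>Both midpoints double to x + y modulo v, and 2 can be cancelled.\<close>
    have "v dvd 2 * (a' - a)" using dvd_diff[OF mid(1,3)] by (simp add: algebra_simps)
    moreover have "\<bar>a' - a\<bar> < v" using mid(5-8) by linarith
    ultimately have a: "a' - a = 0" using half no by blast
    obtain e where e: "e = d \<or> e = - d" "v dvd x - y - 2 * e"
      using mid(2) by (metis diff_minus_eq_add mult_minus_right)
    obtain e' where e': "e' = d' \<or> e' = - d'" "v dvd x - y - 2 * e'"
      using mid(4) by (metis diff_minus_eq_add mult_minus_right)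
    have "v dvd 2 * (e' - e)" using dvd_diff[OF e(2) e'(2)] by (simp add: algebra_simps)
    moreover have "\<bar>e' - e\<bar> < v" using e(1) e'(1) mid(9-12) v_def by auto
    ultimately have "e' - e = 0" using half no by blast
    then show ?thesis using a e(1) e'(1) mid(9,11) by auto
  qed
  from det[OF a d i pq(1-3)]
  consider (ver) "fst p = fst q" "a = fst p" "d = 0" "i = 0"
    | (hor) "fst p \<noteq> fst q" "snd p = snd q" "d > 0" "i = snd p" "v dvd fst p + fst q - 2 * a"
        "v dvd fst p - fst q - 2 * d \<or> v dvd fst p - fst q + 2 * d"
    | (obl) "fst p \<noteq> fst q" "snd p \<noteq> snd q" "R p q a d i \<or> R q p a d i"
    by (elim disjE[of "_ \<and> _"] conjE)
  then show ?thesis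
  proof cases
    case ver
    then show ?thesis using det[OF a' d' i' pq(1,4,5)] by metis
  next
    case hor
    then have "d' > 0" "i' = snd p" "v dvd fst p + fst q - 2 * a'"
      "v dvd fst p - fst q - 2 * d' \<or> v dvd fst p - fst q + 2 * d'"
      using det[OF a' d' i' pq(1,4,5)] by metis+
    then show ?thesis
      using hor mid[OF hor(5,6) _ _ a a' hor(3) d(2) _ d'(2)] by blast
  next
    case obl
    then have "R p q a' d' i' \<or> R q p a' d' i'"
      using det[OF a' d' i' pq(1,4,5)] by metis
    then have "a = a' \<and> d = d' \<and> i = i'"
      using obl(3) R_unique[OF _ _ d d'] R_asym[OF _ _ i(1) i'(1)] by metis
    then show ?thesis by blast
  qed
qed

text \<open>There are v midpoints, t distances and 3 levels, and v columns besides: v (3 t + 1)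
  blocks. With m = 3 v this is m (m - 1) / 6, the size of a full Steiner triple system. The 3 v
  blocks with d = 1 suffice for the covering, each point being an end of two of them.\<close>

lemma bose_blocks:
  fixes t :: int
  defines "v \<equiv> 2 * t + 1"
  assumes t: "t \<ge> 1" and n: "3 * nat v \<le> n" "n \<le> nat v * (3 * nat t + 1)"
  obtains \<C> where "partial_triple_system (triple_points v) \<C>" "doubly_covering (triple_points v) \<C>"
    "finite \<C>" "card \<C> = n"
proof -
  define I where "I = {0..<v} \<times> ({1..t} \<times> {0, 1, 2} \<union> {(0, 0::nat)})"
  define J where "J = {0..<v} \<times> {1::int} \<times> {0, 1, 2::nat}"
  have v: "v > 0" "v \<ge> 3" using t by (auto simp: v_def)
  have cardI: "card I = nat v * (3 * nat t + 1)"
    unfolding I_def by (subst card_cartesian_product, subst card_Un_disjoint) (auto simp: card_cartesian_product)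
  have cardJ: "card J = 3 * nat v" unfolding J_def card_cartesian_product by simp
  have JI: "J \<subseteq> I" using t by (auto simp: J_def I_def)
  have sub: "bose_block v i \<subseteq> triple_points v \<and> card (bose_block v i) = 3" if "i \<in> I" for i
  proof -
    obtain a d l where i: "i = (a, d, l)" by (cases i)
    show ?thesis
    proof (cases "d = 0")
      case True
      then show ?thesis using that i by (auto simp: bose_block_def I_def triple_points_def card_cartesian_product)
    next
      case False
      have "(a - d) mod v \<noteq> (a + d) mod v"
      proof
        assume "(a - d) mod v = (a + d) mod v"
        then have "v dvd 2 * d" by (simp add: mod_eq_dvd_iff flip: dvd_minus_iff[of v "a - d - (a + d)"])
        then have "v dvd d" using dvd_double_odd[of v d] v_def by simp
        then show False using False that i zdvd_not_zless[of d v] by (auto simp: I_def v_def)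
      qed
      moreover have "l \<noteq> (l + 1) mod 3" "(l + 1) mod 3 \<in> {0, 1, 2}" "l \<in> {0, 1, 2}" using that i by (auto simp: I_def)
      ultimately show ?thesis using that i v False
        by (simp add: bose_block_def I_def triple_points_def)
    qed
  qed
  have inter: "i = i'"
    if "i \<in> I" "i' \<in> I" "p \<noteq> q" "p \<in> bose_block v i" "q \<in> bose_block v i"
      "p \<in> bose_block v i'" "q \<in> bose_block v i'" for i i' p q
  proof -
    obtain a d l a' d' l' where ii: "i = (a, d, l)" "i' = (a', d', l')" by (cases i; cases i')
    show ?thesis
      using that bose_block_inter[of a t d l a' d' l' p q] unfolding ii v_def I_def by auto
  qed
  have fam: "partial_triple_system (triple_points v) (bose_block v ` I)" "inj_on (bose_block v) I"
    using partial_triple_system_family[of I "bose_block v" "triple_points v"] sub inter by metis+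
  have cJ: "card (bose_block v ` J) \<le> n"
    using n cardJ card_image[OF inj_on_subset[OF fam(2) JI]] by simp
  have cI: "n \<le> card (bose_block v ` I)"
    using n cardI card_image[OF fam(2)] by simp
  have cover: "doubly_covering (triple_points v) (bose_block v ` J)"
    unfolding doubly_covering_def
  proof
    fix p assume "p \<in> triple_points v"
    then obtain x i where p: "p = (x, i)" "0 \<le> x" "x < v" "i \<in> {0, 1, 2}" by (auto simp: triple_points_def)
    \<comment> \<open>For d = 1 the residue x is an end of the blocks around x - 1 and x + 1; these
      midpoints differ because v \<ge> 3.\<close>
    define a where "a = (x - 1) mod v"
    define b where "b = (x + 1) mod v"
    have "p \<in> bose_block v (a, 1, i)" "p \<in> bose_block v (b, 1, i)"
      using p v by (auto simp: bose_block_def a_def b_def mod_simps)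
    moreover have "(a, 1, i) \<in> J" "(b, 1, i) \<in> J" using p v by (auto simp: J_def a_def b_def)
    moreover have "a \<noteq> b"
    proof
      assume "a = b"
      then have "v dvd 2" by (simp add: a_def b_def mod_eq_dvd_iff)
      then show False using v zdvd_not_zless[of 2 v] by simp
    qed
    moreover from this calculation have "bose_block v (a, 1, i) \<noteq> bose_block v (b, 1, i)"
      using JI inj_onD[OF fam(2), of "(a, 1, i)" "(b, 1, i)"] by auto
    ultimately show "\<exists>b\<in>bose_block v ` J. \<exists>b'\<in>bose_block v ` J. b \<noteq> b' \<and> p \<in> b \<and> p \<in> b'"
      by blast
  qed
  have "finite (bose_block v ` I)" by (auto simp: I_def)
  then show ?thesis
    using doubly_covering_subsystem[OF fam(1) _ image_mono[OF JI] cover cJ cI] that by metis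
qed

text \<open>Write m = 3 v with v odd. Bose's blocks serve 3 v \<le> n \<le> m (m - 1) / 6. For 2 v
  \<le> n < 3 v the transversal design is used, which has v^2 \<ge> 3 v blocks.\<close>

lemma doubly_covering_triples_exist:
  fixes m n :: nat
  assumes m: "m mod 6 = 3" and n: "2 * m \<le> 3 * n" "6 * n \<le> m * (m - 1)"
  obtains V :: "(int \<times> nat) set" and \<C> where "card V = m" "finite V"
    "partial_triple_system V \<C>" "doubly_covering V \<C>" "finite \<C>" "card \<C> = n"
proof -
  define s where "s = m div 6"
  have ms: "m = 3 * (2 * s + 1)" using m mult_div_mod_eq[of 6 m] by (simp add: s_def)
  define v :: int where "v = 2 * int s + 1"
  have nv: "nat v = 2 * s + 1" by (simp add: v_def nat_add_distrib nat_mult_distrib)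
  \<comment> \<open>For m = 3 the bounds would read 2 \<le> n \<le> 1.\<close>
  have s: "s \<ge> 1"
  proof (rule ccontr)
    assume "\<not> s \<ge> 1"
    then have "m = 3" using ms by simp
    then show False using n by simp
  qed
  have n1: "2 * nat v \<le> n" using n(1) ms nv by simp
  have "m - 1 = 2 * (3 * s + 1)" using ms by simp
  then have "m * (m - 1) = 6 * (nat v * (3 * nat (int s) + 1))"
    unfolding nv by (simp add: ms algebra_simps)
  then have n2: "n \<le> nat v * (3 * nat (int s) + 1)" using n(2) by simp
  have V: "card (triple_points v) = m" "finite (triple_points v)"
    using card_triple_points[of v] ms nv by (simp_all add: triple_points_def)
  show ?thesis
  proof (cases "3 * nat v \<le> n")
    case True
    then obtain \<C> where "partial_triple_system (triple_points v) \<C>" "doubly_covering (triple_points v) \<C>"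
      "finite \<C>" "card \<C> = n"
      using bose_blocks[of "int s" n] n2 s unfolding v_def by auto
    then show ?thesis using that V by blast
  next
    case False
    have "3 \<le> nat v" using s nv by simp
    then have "3 * nat v \<le> nat v * nat v" by simp
    then have "n \<le> nat v * nat v" using False by linarith
    then obtain \<C> where "partial_triple_system (triple_points v) \<C>" "doubly_covering (triple_points v) \<C>"
      "finite \<C>" "card \<C> = n"
      using td_blocks[of "int s" n] n1 s unfolding v_def by auto
    then show ?thesis using that V by blast
  qed
qed

section \<open>Threshold schemes from triple systems\<close>

definition block_share :: "(nat \<Rightarrow> 'p) \<Rightarrow> ('p \<Rightarrow> 'a) \<Rightarrow> 'a \<times> 'a \<times> 'a" where
  "block_share b f = (f (b 0), f (b 1), f (b 2))"

definition triple_component :: "nat \<Rightarrow> 'a \<times> 'a \<times> 'a \<Rightarrow> 'a" where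
  "triple_component j = (\<lambda>(a, b, c). if j = 0 then a else if j = 1 then b else c)"

lemma triple_component_block_share: "j < 3 \<Longrightarrow> triple_component j (block_share b f) = f (b j)"
  by (auto simp: triple_component_def block_share_def less_Suc_eq numeral_3_eq_3 numeral_2_eq_2)

section \<open>Values of polynomials given by coefficient lists\<close>

context field
begin

text \<open>A list may begin with zeros, so it is normalized first. A nonempty normalized list has
  degree below its length, hence fewer than \<open>card A\<close> roots.\<close>

lemma eval_zero_on_imp_zero:
  assumes p: "set p \<subseteq> carrier R" and A: "A \<subseteq> carrier R" "length p \<le> card A" "finite A"
    and 0: "\<And>x. x \<in> A \<Longrightarrow> eval p x = \<zero>"
  shows "set p \<subseteq> {\<zero>}"
proof -
  let ?r = "normalize p"
  have r: "?r \<in> carrier (poly_ring R)"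
    using normalize_gives_polynomial[OF p] by (simp add: univ_poly_carrier[symmetric])
  have "?r = []"
  proof (rule ccontr)
    assume ne: "?r \<noteq> []"
    have "A \<subseteq> set_mset (roots ?r)"
    proof
      fix x assume x: "x \<in> A"
      then have "eval ?r x = \<zero>" using 0 eval_normalize[OF p] A(1) by auto
      then have "is_root ?r x" using x A(1) ne by (auto simp: is_root_def)
      then show "x \<in># roots ?r" using roots_mem_iff_is_root[OF r] by simp
    qed
    then have "card A \<le> card (set_mset (roots ?r))" by (simp add: card_mono)
    also have "\<dots> \<le> size (roots ?r)" by (metis mset_set_set_mset_msubset size_mset_mono size_mset_set)
    also have "\<dots> \<le> degree ?r" by (rule size_roots_le_degree[OF r])
    also have "\<dots> < length ?r" using ne by (cases ?r) auto
    also have "\<dots> \<le> length p" by (rule normalize_length_le)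
    finally show False using A(2) by simp
  qed
  \<comment> \<open>A list that normalizes to the empty list has only zero entries.\<close>
  then show ?thesis
    using normalize_def'(1)[of p]
    by (metis append_Nil2 drop_all in_set_replicate diff_zero insertI1 list.size(3) order_refl subsetI)
qed

lemma eval_map2_minus:
  assumes "length p = length q" "set p \<subseteq> carrier R" "set q \<subseteq> carrier R" "x \<in> carrier R"
  shows "eval (map2 (\<lambda>a b. a \<ominus> b) p q) x = eval p x \<ominus> eval q x"
  using assms
proof (induction p q rule: list_induct2)
  case Nil
  then show ?case by (simp add: a_minus_def)
next
  case (Cons a p b q)
  then have "eval p x \<in> carrier R" "eval q x \<in> carrier R" by (auto intro: eval_in_carrier)
  with Cons show ?case
    by (simp add: a_minus_def l_distr a_ac local.minus_add l_minus)
qed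

text \<open>The root bound is applied to the coefficientwise difference. The lists agree with their
  leading zeros included, so the secret can be read off at the top positions.\<close>

lemma eval_inj:
  assumes len: "length p = length q" "length p \<le> card A"
    and pq: "set p \<subseteq> carrier R" "set q \<subseteq> carrier R" and A: "A \<subseteq> carrier R" "finite A"
    and eq: "\<And>x. x \<in> A \<Longrightarrow> eval p x = eval q x"
  shows "p = q"
proof -
  let ?d = "map2 (\<lambda>a b. a \<ominus> b) p q"
  have nth: "p ! i \<in> carrier R \<and> q ! i \<in> carrier R" if "i < length p" for i
    using that len(1) pq by (metis nth_mem subsetD)
  have "set ?d \<subseteq> {\<zero>}"
  proof (rule eval_zero_on_imp_zero[OF _ A(1) _ A(2)])
    show "set ?d \<subseteq> carrier R" using nth len(1) by (auto simp: set_conv_nth)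
    show "length ?d \<le> card A" using len by simp
    show "eval ?d x = \<zero>" if "x \<in> A" for x
      using that eval_map2_minus[OF len(1) pq] eq A(1) eval_in_carrier[OF pq(2)]
      by (auto simp: subset_iff r_right_minus_eq)
  qed
  then have "p ! i \<ominus> q ! i = \<zero>" if "i < length p" for i
    using that len(1) by (auto simp: set_conv_nth image_subset_iff)
  then show ?thesis
    using nth len(1) by (intro nth_equalityI) (auto simp: r_right_minus_eq)
qed

text \<open>Coefficient lists begin with the leading coefficient: \<open>s\<close>, the secret,
  holds degrees 4 and 3, and the random \<open>r\<close> holds degrees 2, 1 and 0.\<close>

definition ramp_eval :: "'a \<times> 'a \<Rightarrow> 'a \<times> 'a \<times> 'a \<Rightarrow> 'a \<Rightarrow> 'a" where
  "ramp_eval s r x = eval [fst s, snd s, fst r, fst (snd r), snd (snd r)] x"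

abbreviation "triples \<equiv> carrier R \<times> carrier R \<times> carrier R"

lemma ramp_eval_closed:
  "s \<in> carrier R \<times> carrier R \<Longrightarrow> r \<in> triples \<Longrightarrow> x \<in> carrier R \<Longrightarrow> ramp_eval s r x \<in> carrier R"
  unfolding ramp_eval_def by (rule eval_in_carrier) auto

lemma ramp_eval_determines_secret:
  assumes "s \<in> carrier R \<times> carrier R" "s' \<in> carrier R \<times> carrier R" "r \<in> triples" "r' \<in> triples"
    and "A \<subseteq> carrier R" "5 \<le> card A"
    and "\<And>x. x \<in> A \<Longrightarrow> ramp_eval s r x = ramp_eval s' r' x"
  shows "s = s'"
proof -
  have "finite A" using assms(6) by (metis card.infinite not_numeral_le_zero)
  then have "[fst s, snd s, fst r, fst (snd r), snd (snd r)] =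
             [fst s', snd s', fst r', fst (snd r'), snd (snd r')]"
    using assms unfolding ramp_eval_def by (intro eval_inj[of _ _ A]) auto
  then show ?thesis by (auto simp: prod_eq_iff)
qed

text \<open>With the top coefficients fixed, what is left is a quadratic, determined by its values
  at three distinct points; finiteness then gives surjectivity. This is why a single share reveals
  nothing.\<close>

lemma bij_betw_block_share:
  assumes fin: "finite (carrier R)" and s: "s \<in> carrier R \<times> carrier R"
    and b: "inj_on b {..<3}" "b ` {..<3} \<subseteq> carrier R"
  shows "bij_betw (\<lambda>r. block_share b (ramp_eval s r)) triples triples"
proof -
  have bc: "b 0 \<in> carrier R" "b 1 \<in> carrier R" "b 2 \<in> carrier R" using b(2) by auto
  have "inj_on (\<lambda>r. block_share b (ramp_eval s r)) triples"
  proof (rule inj_onI)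
    fix r r' assume r: "r \<in> triples" "r' \<in> triples"
      and eq: "block_share b (ramp_eval s r) = block_share b (ramp_eval s r')"
    have "eval [fst r, fst (snd r), snd (snd r)] x = eval [fst r', fst (snd r'), snd (snd r')] x"
      if "x \<in> b ` {..<3}" for x
    proof -
      have x: "x \<in> carrier R" using that b(2) by auto
      from that obtain i where "i < 3" "x = b i" by auto
      then have "i = 0 \<or> i = 1 \<or> i = 2" "x = b i" by auto
      then have "ramp_eval s r x = ramp_eval s r' x" using eq by (auto simp: block_share_def)
      moreover have "eval [fst r, fst (snd r), snd (snd r)] x \<in> carrier R"
        "eval [fst r', fst (snd r'), snd (snd r')] x \<in> carrier R"
        using r x by (auto intro!: eval_in_carrier)
      \<comment> \<open>The terms of degree 4 and 3 are the same on both sides and cancel.\<close>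
      ultimately show ?thesis
        using s x unfolding ramp_eval_def eval.simps(2)[of "fst s"] eval.simps(2)[of "snd s"] list.sel
        by (auto simp del: eval.simps)
    qed
    moreover have "3 \<le> card (b ` {..<3})" using b(1) by (simp add: card_image)
    ultimately have "[fst r, fst (snd r), snd (snd r)] = [fst r', fst (snd r'), snd (snd r')]"
      using r b(2) by (intro eval_inj[of _ _ "b ` {..<3}"]) auto
    then show "r = r'" by (auto simp: prod_eq_iff)
  qed
  moreover have "(\<lambda>r. block_share b (ramp_eval s r)) ` triples \<subseteq> triples"
    using ramp_eval_closed[OF s] bc by (auto simp: block_share_def)
  ultimately show ?thesis
    using endo_inj_surj[of triples "\<lambda>r. block_share b (ramp_eval s r)"] fin by (simp add: bij_betw_def)
qed

end

section \<open>The threshold scheme given by one block of field elements per player\<close>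

locale block_ramp_scheme = field R for R :: "('a, 'b) ring_scheme" (structure) +
  fixes n :: nat and pt :: "nat \<Rightarrow> nat \<Rightarrow> 'a"
  assumes fin: "finite (carrier R)"
    and n: "2 \<le> n"
    and pt_inj: "i \<in> {1..n} \<Longrightarrow> inj_on (pt i) {..<3}"
    and pt_carrier: "i \<in> {1..n} \<Longrightarrow> pt i ` {..<3} \<subseteq> carrier R"
    and pt_inter: "i \<in> {1..n} \<Longrightarrow> i' \<in> {1..n} \<Longrightarrow> i \<noteq> i' \<Longrightarrow> card (pt i ` {..<3} \<inter> pt i' ` {..<3}) \<le> 1"
    and pt_cover: "i \<in> {1..n} \<Longrightarrow> j < 3 \<Longrightarrow> \<exists>i'\<in>{1..n} - {i}. pt i j \<in> pt i' ` {..<3}"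
begin

text \<open>Pairs of field elements are numbered, since the theorem asks for secrets of type
  \<open>nat\<close>; \<open>secret_pair\<close> decodes them.\<close>

definition secrets :: "nat set" where
  "secrets = {..<card (carrier R \<times> carrier R)}"

lemma card_secrets: "card secrets = card (carrier R) * card (carrier R)"
  by (simp add: secrets_def card_cartesian_product)

definition secret_pair :: "nat \<Rightarrow> 'a \<times> 'a" where
  "secret_pair = (SOME g. bij_betw g secrets (carrier R \<times> carrier R))"

lemma bij_betw_secret_pair: "bij_betw secret_pair secrets (carrier R \<times> carrier R)"
proof -
  obtain g where "bij_betw g secrets (carrier R \<times> carrier R)"
    using ex_bij_betw_nat_finite[of "carrier R \<times> carrier R"] fin
    by (auto simp: secrets_def atLeast0LessThan)
  then show ?thesis unfolding secret_pair_def
    by (rule someI[where P = "\<lambda>g. bij_betw g secrets (carrier R \<times> carrier R)"])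
qed

lemma secret_pair_closed: "\<kappa> \<in> secrets \<Longrightarrow> secret_pair \<kappa> \<in> carrier R \<times> carrier R"
  using bij_betw_secret_pair by (auto simp: bij_betw_def)

lemma card_carrier_ge_2: "2 \<le> card (carrier R)"
proof -
  have "card {\<zero>, \<one>} \<le> card (carrier R)" using fin by (intro card_mono) auto
  then show ?thesis by simp
qed

definition shares :: "nat \<Rightarrow> 'a \<times> 'a \<times> 'a \<Rightarrow> nat \<Rightarrow> 'a \<times> 'a \<times> 'a" where
  "shares \<kappa> r i = block_share (pt i) (ramp_eval (secret_pair \<kappa>) r)"

definition dealer :: "nat \<Rightarrow> (nat \<Rightarrow> 'a \<times> 'a \<times> 'a) pmf" where
  "dealer \<kappa> = map_pmf (shares \<kappa>) (pmf_of_set triples)"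

lemma triples_finite_nonempty: "finite triples" "triples \<noteq> {}"
  using fin by auto

lemma set_dealer: "set_pmf (dealer \<kappa>) = shares \<kappa> ` triples"
  unfolding dealer_def using triples_finite_nonempty by simp

lemma component_share: "j < 3 \<Longrightarrow> triple_component j (shares \<kappa> r i) = ramp_eval (secret_pair \<kappa>) r (pt i j)"
  by (simp add: shares_def triple_component_block_share)

lemma bij_betw_share:
  assumes "\<kappa> \<in> secrets" "i \<in> {1..n}"
  shows "bij_betw (\<lambda>r. shares \<kappa> r i) triples triples"
  unfolding shares_def
  by (rule bij_betw_block_share[OF fin secret_pair_closed[OF assms(1)] pt_inj[OF assms(2)] pt_carrier[OF assms(2)]])

lemma share_uniform:
  assumes "\<kappa> \<in> secrets" "i \<in> {1..n}"
  shows "map_pmf (\<lambda>\<sigma>. \<sigma> i) (dealer \<kappa>) = pmf_of_set triples"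
  using map_pmf_of_set_bij_betw[OF bij_betw_share[OF assms] triples_finite_nonempty(2,1)]
  by (simp add: dealer_def pmf.map_comp comp_def)

text \<open>Each share is uniform whatever the secret, so anything computed from it by one fixed
  \<open>g\<close> is independent of the secret. Privacy of the shares and of the repair both reduce
  to this, coalitions being single players.\<close>

lemma single_share_view:
  assumes "\<kappa> \<in> secrets" "\<kappa>' \<in> secrets" "i \<in> {1..n}"
    and view: "\<And>\<kappa> \<sigma>. \<kappa> \<in> secrets \<Longrightarrow> \<sigma> \<in> set_pmf (dealer \<kappa>) \<Longrightarrow> view \<sigma> = g (\<sigma> i)"
  shows "map_pmf view (dealer \<kappa>) = map_pmf view (dealer \<kappa>')"
proof -
  have "map_pmf view (dealer \<kappa>) = map_pmf g (pmf_of_set triples)" if "\<kappa> \<in> secrets" for \<kappa>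
  proof -
    have "map_pmf view (dealer \<kappa>) = map_pmf (\<lambda>\<sigma>. g (\<sigma> i)) (dealer \<kappa>)"
      using view that by (intro map_pmf_cong) auto
    also have "\<dots> = map_pmf g (map_pmf (\<lambda>\<sigma>. \<sigma> i) (dealer \<kappa>))" by (simp add: pmf.map_comp comp_def)
    finally show ?thesis using share_uniform[OF that assms(3)] by simp
  qed
  then show ?thesis using assms(1,2) by simp
qed

text \<open>Two blocks have at least 3 + 3 - 1 = 5 points together, as many as there are
  coefficients.\<close>

lemma two_shares_determine_secret:
  assumes \<kappa>: "\<kappa> \<in> secrets" "\<kappa>' \<in> secrets" and r: "r \<in> triples" "r' \<in> triples"
    and i: "i \<in> {1..n}" "i' \<in> {1..n}" "i \<noteq> i'"
    and eq: "shares \<kappa> r i = shares \<kappa>' r' i" "shares \<kappa> r i' = shares \<kappa>' r' i'"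
  shows "\<kappa> = \<kappa>'"
proof -
  let ?B = "pt i ` {..<3}" and ?B' = "pt i' ` {..<3}"
  have "card ?B = 3" "card ?B' = 3" using pt_inj i by (simp_all add: card_image)
  then have "5 \<le> card (?B \<union> ?B')"
    using card_Un_Int[of ?B ?B'] pt_inter[OF i] by simp
  moreover have "?B \<union> ?B' \<subseteq> carrier R" using pt_carrier i by auto
  moreover have "ramp_eval (secret_pair \<kappa>) r x = ramp_eval (secret_pair \<kappa>') r' x" if "x \<in> ?B \<union> ?B'" for x
    using that eq by (auto simp flip: component_share)
  ultimately have "secret_pair \<kappa> = secret_pair \<kappa>'"
    using ramp_eval_determines_secret[OF secret_pair_closed[OF \<kappa>(1)] secret_pair_closed[OF \<kappa>(2)] r] by blast
  then show ?thesis using \<kappa> bij_betw_secret_pair by (auto simp: bij_betw_def dest: inj_onD)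
qed

lemma threshold_scheme: "threshold_scheme 2 n secrets triples dealer"
  unfolding threshold_scheme_def
proof (intro conjI allI impI ballI)
  show "finite secrets" by (simp add: secrets_def)
  have "0 < card (carrier R)" using card_carrier_ge_2 by linarith
  then show "secrets \<noteq> {}" by (auto simp: secrets_def card_cartesian_product lessThan_empty_iff)
  show "finite triples" by (rule triples_finite_nonempty)
next
  fix \<kappa> \<sigma> i assume "\<kappa> \<in> secrets" "\<sigma> \<in> set_pmf (dealer \<kappa>)" "i \<in> {1..n}"
  then show "\<sigma> i \<in> triples"
    using bij_betw_share[of \<kappa> i] unfolding set_dealer bij_betw_def by blast
next
  fix A assume A: "A \<subseteq> {1..n} \<and> card A = 2"
  then obtain i i' where i: "A = {i, i'}" "i \<noteq> i'" by (auto simp: card_2_iff)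
  \<comment> \<open>The players pick a secret compatible with their shares;
    \<open>two_shares_determine_secret\<close> shows that there is only one.\<close>
  define rec where "rec = (\<lambda>\<tau>. SOME \<kappa>. \<kappa> \<in> secrets \<and> (\<exists>r\<in>triples. \<tau> = restrict (shares \<kappa> r) A))"
  have "rec (restrict \<sigma> A) = \<kappa>" if \<kappa>: "\<kappa> \<in> secrets" "\<sigma> \<in> set_pmf (dealer \<kappa>)" for \<kappa> \<sigma>
  proof -
    from \<kappa> obtain r where r: "r \<in> triples" "\<sigma> = shares \<kappa> r" by (auto simp: set_dealer)
    show ?thesis unfolding rec_def
    proof (rule some_equality)
      show "\<kappa> \<in> secrets \<and> (\<exists>r\<in>triples. restrict \<sigma> A = restrict (shares \<kappa> r) A)" using \<kappa> r by blast
    next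
      fix \<kappa>' assume "\<kappa>' \<in> secrets \<and> (\<exists>r\<in>triples. restrict \<sigma> A = restrict (shares \<kappa>' r) A)"
      then obtain r' where r': "\<kappa>' \<in> secrets" "r' \<in> triples" "restrict \<sigma> A = restrict (shares \<kappa>' r') A" by blast
      have "shares \<kappa> r i = shares \<kappa>' r' i" "shares \<kappa> r i' = shares \<kappa>' r' i'"
        using fun_cong[OF r'(3), of i] fun_cong[OF r'(3), of i'] i r by simp_all
      then show "\<kappa>' = \<kappa>"
        using two_shares_determine_secret[OF \<kappa>(1) r'(1) r(1) r'(2)] A i by auto
    qed
  qed
  then show "\<exists>reconstruct. \<forall>\<kappa>\<in>secrets. \<forall>\<sigma>\<in>set_pmf (dealer \<kappa>). reconstruct (restrict \<sigma> A) = \<kappa>" by blast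
next
  fix A \<kappa> \<kappa>' assume A: "A \<subseteq> {1..n} \<and> card A = 2 - 1" and \<kappa>: "\<kappa> \<in> secrets" "\<kappa>' \<in> secrets"
  then obtain i where i: "A = {i}" "i \<in> {1..n}" by (auto simp: card_1_singleton_iff)
  show "map_pmf (\<lambda>\<sigma>. restrict \<sigma> A) (dealer \<kappa>) = map_pmf (\<lambda>\<sigma>. restrict \<sigma> A) (dealer \<kappa>')"
    by (rule single_share_view[OF \<kappa> i(2), of _ "\<lambda>x. restrict (\<lambda>_. x) A"])
      (auto simp: i(1) restrict_def)
qed (use n in auto)

section \<open>Information rate and repair of a lost share\<close>

lemma log_card_carrier: "log 2 (real (card (carrier R))) \<noteq> 0" "0 < card (carrier R)"
proof -
  show "0 < card (carrier R)" using card_carrier_ge_2 by linarith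
  have "0 < log 2 (real (card (carrier R)))" using card_carrier_ge_2 by simp
  then show "log 2 (real (card (carrier R))) \<noteq> 0" by linarith
qed

lemma information_rate: "information_rate secrets triples = 2 / 3"
  using log_card_carrier
  by (simp add: information_rate_def card_secrets card_cartesian_product log_mult)

text \<open>Each point of the lost block lies on another block, whose player sends the value there.
  Every message is a component both of the sender's share and of the lost share, so a player's view
  is a function of its own share. Three field elements are sent, against two in the secret.\<close>

lemma repairing_protocol_exists:
  assumes l: "l \<in> {1..n}"
  shows "\<exists>H (P :: ('a \<times> 'a \<times> 'a, nat, nat) repair_protocol).
    H \<subseteq> {1..n} - {l} \<and> card H = 3 \<and> secure_repairing_protocol 2 n secrets dealer l H P \<and>
    communication_complexity secrets dealer H P = 3 / 2"
proof -
  have "\<forall>j\<in>{..<3}. \<exists>i k. i \<in> {1..n} - {l} \<and> k < 3 \<and> pt l j = pt i k"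
    using pt_cover[OF l] by (metis (no_types, lifting) imageE lessThan_iff)
  \<comment> \<open>Helper \<open>h j\<close> serves point j of the lost block, which is point
    \<open>s j\<close> of the helper's own block.\<close>
  then obtain h s where hs: "\<And>j. j < 3 \<Longrightarrow> h j \<in> {1..n} - {l} \<and> s j < 3 \<and> pt l j = pt (h j) (s j)"
    unfolding bchoice_iff by (metis lessThan_iff)
  \<comment> \<open>A helper serving two points would have a block meeting the lost one
    twice.\<close>
  have h_inj: "inj_on h {..<3}"
  proof (rule inj_onI)
    fix j j' assume j: "j \<in> {..<3}" "j' \<in> {..<3}" "h j = h j'"
    have "pt l k \<in> pt l ` {..<3} \<inter> pt (h k) ` {..<3}" if "k < 3" for k
      using hs[OF that] that
      by (intro IntI image_eqI[of _ "pt l" k] image_eqI[of _ "pt (h k)" "s k"]) auto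
    from this[of j] this[of j']
    have "pt l j \<in> pt l ` {..<3} \<inter> pt (h j) ` {..<3}" "pt l j' \<in> pt l ` {..<3} \<inter> pt (h j) ` {..<3}"
      using j by simp_all
    moreover have "card (pt l ` {..<3} \<inter> pt (h j) ` {..<3}) \<le> Suc 0"
      using pt_inter[OF l, of "h j"] hs[of j] j by auto
    moreover have "finite (pt l ` {..<3} \<inter> pt (h j) ` {..<3})" by simp
    ultimately have "pt l j = pt l j'" using card_le_Suc0_iff_eq by blast
    then show "j = j'" using pt_inj[OF l] j by (auto dest: inj_onD)
  qed
  define H where "H = h ` {..<3}"
  \<comment> \<open>This inverts \<open>h\<close>, telling a helper which point of the lost block it
    serves.\<close>
  define slot where "slot = inv_into {..<3} h"
  have slot: "slot (h j) = j" if "j < 3" for j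
    using that h_inj by (simp add: slot_def inv_into_f_f)
  have H: "H \<subseteq> {1..n} - {l}" "card H = 3" "finite H"
    using hs h_inj by (auto simp: H_def card_image)
  obtain enc :: "'a \<Rightarrow> nat" where enc: "inj_on enc (carrier R)"
    using finite_imp_inj_to_nat_seg[OF fin] by blast
  define P :: "('a \<times> 'a \<times> 'a, nat, nat) repair_protocol" where
    "P = \<lparr>randomness = (\<lambda>_. return_pmf 0), exchange_msg = (\<lambda>_ _ _ _. None),
          repair_msg = (\<lambda>i x _ _. Some (enc (triple_component (s (slot i)) x))),
          recover = (\<lambda>M. block_share h (\<lambda>i. inv_into (carrier R) enc (the (M i))))\<rparr>"
  have exch: "exchange_sent H P \<sigma> \<rho> i j = None" for \<sigma> \<rho> i j
    by (simp add: exchange_sent_def P_def)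
  have rep: "repair_sent H P \<sigma> \<rho> i =
      (if i \<in> H then Some (enc (triple_component (s (slot i)) (\<sigma> i))) else None)" for \<sigma> \<rho> i
    by (simp add: repair_sent_def P_def)
  \<comment> \<open>The repaired player receives only components of its own share; its privacy rests
    on this.\<close>
  have comp: "triple_component (s (slot i)) (shares \<kappa> r i) = triple_component (slot i) (shares \<kappa> r l)"
    if "i \<in> H" for i \<kappa> r
    using that hs by (auto simp: H_def slot component_share)
  have fst_exec: "fst ` executions secrets dealer H P = (\<Union>\<kappa>\<in>secrets. shares \<kappa> ` triples)"
    by (auto simp: executions_def execution_def set_dealer image_UN image_Union set_pmf_not_empty)
  have "secrets \<noteq> {}" using threshold_scheme by (simp add: threshold_scheme_def)
  then obtain \<kappa>0 where \<kappa>0: "\<kappa>0 \<in> secrets" by blast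
  \<comment> \<open>Silence is the only value on an exchange channel, which therefore has bit-length
    log 1 = 0.\<close>
  have ex_val: "exchange_values secrets dealer H P i j = {None}" for i j
  proof -
    have "executions secrets dealer H P \<noteq> {}"
      using \<kappa>0 by (auto simp: executions_def set_pmf_not_empty)
    then show ?thesis by (auto simp: exchange_values_def exch)
  qed
  \<comment> \<open>The complexity counts the values that occur, so the exact set is computed: a
    helper's share runs through all triples, hence its component through the whole field.\<close>
  have rep_val: "repair_values secrets dealer H P i = (Some \<circ> enc) ` carrier R" if i: "i \<in> H" for i
  proof -
    have i': "i \<in> {1..n}" using i H by auto
    have s: "s (slot i) < 3" using i hs by (auto simp: H_def slot)
    have closed: "triple_component k x \<in> carrier R" if "x \<in> triples" for k x
      using that by (auto simp: triple_component_def)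
    have "repair_values secrets dealer H P i =
        (\<lambda>\<sigma>. Some (enc (triple_component (s (slot i)) (\<sigma> i)))) ` fst ` executions secrets dealer H P"
      using i by (auto simp: repair_values_def rep image_image case_prod_unfold)
    also have "\<dots> = (Some \<circ> enc) ` (\<Union>\<kappa>\<in>secrets. triple_component (s (slot i)) ` (\<lambda>r. shares \<kappa> r i) ` triples)"
      unfolding fst_exec by (auto simp: image_UN image_image)
    also have "(\<Union>\<kappa>\<in>secrets. triple_component (s (slot i)) ` (\<lambda>r. shares \<kappa> r i) ` triples) =
        (\<Union>\<kappa>\<in>secrets. triple_component (s (slot i)) ` triples)"
      using bij_betw_share[OF _ i'] by (simp add: bij_betw_def)
    also have "\<dots> = triple_component (s (slot i)) ` triples" using \<kappa>0 by auto
    also have "\<dots> = carrier R"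
    proof
      show "triple_component (s (slot i)) ` triples \<subseteq> carrier R" using closed by auto
      show "carrier R \<subseteq> triple_component (s (slot i)) ` triples"
      proof
        fix y assume "y \<in> carrier R"
        then have "(y, y, y) \<in> triples" "y = triple_component (s (slot i)) (y, y, y)"
          by (auto simp: triple_component_def)
        then show "y \<in> triple_component (s (slot i)) ` triples" by (metis image_eqI)
      qed
    qed
    finally show ?thesis .
  qed
  have recover: "recover P (repair_sent H P \<sigma> \<rho>) = \<sigma> l" if "(\<sigma>, \<rho>) \<in> executions secrets dealer H P" for \<sigma> \<rho>
  proof -
    have "\<sigma> \<in> fst ` executions secrets dealer H P" using that by force
    then obtain \<kappa> r where \<kappa>: "\<kappa> \<in> secrets" "r \<in> triples" "\<sigma> = shares \<kappa> r" unfolding fst_exec by auto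
    have "inv_into (carrier R) enc (the (repair_sent H P \<sigma> \<rho> (h j))) = ramp_eval (secret_pair \<kappa>) r (pt l j)"
      if j: "j < 3" for j
    proof -
      have "pt l j \<in> carrier R" using pt_carrier[OF l] j by auto
      then have "ramp_eval (secret_pair \<kappa>) r (pt l j) \<in> carrier R"
        using ramp_eval_closed[OF secret_pair_closed] \<kappa> by blast
      moreover have "h j \<in> H" using j by (simp add: H_def)
      moreover have "triple_component (s j) (\<sigma> (h j)) = ramp_eval (secret_pair \<kappa>) r (pt l j)"
        using hs[OF j] \<kappa> by (simp add: component_share)
      ultimately show ?thesis using j enc by (simp add: rep slot inv_into_f_f)
    qed
    from this[of 0] this[of 1] this[of 2] show ?thesis
      unfolding \<kappa>(3) shares_def by (simp add: P_def block_share_def)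
  qed
  have privacy: "map_pmf (coalition_view l H P C) (execution H P (dealer \<kappa>)) =
      map_pmf (coalition_view l H P C) (execution H P (dealer \<kappa>'))"
    if C: "C \<subseteq> {1..n}" "card C = 1" and \<kappa>: "\<kappa> \<in> secrets" "\<kappa>' \<in> secrets" for C \<kappa> \<kappa>'
  proof -
    obtain c where c: "C = {c}" "c \<in> {1..n}" using C by (auto simp: card_1_singleton_iff)
    \<comment> \<open>The protocol is deterministic, so the view does not depend on the randomness
      and \<open>undefined\<close> can stand in for it.\<close>
    define W where "W = (\<lambda>\<sigma>. coalition_view l H P C (\<sigma>, undefined))"
    have W: "coalition_view l H P C = W \<circ> fst"
      by (auto simp: W_def coalition_view_def exch rep fun_eq_iff)
    have view: "map_pmf (coalition_view l H P C) (execution H P (dealer \<kappa>)) = map_pmf W (dealer \<kappa>)" for \<kappa>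
      unfolding W execution_def by (simp add: map_fst_pair_pmf flip: pmf.map_comp)
    have "map_pmf W (dealer \<kappa>) = map_pmf W (dealer \<kappa>')"
    proof (rule single_share_view[OF \<kappa> c(2)])
      fix \<kappa> \<sigma> assume "\<kappa> \<in> secrets" "\<sigma> \<in> set_pmf (dealer \<kappa>)"
      then obtain r where r: "\<sigma> = shares \<kappa> r" by (auto simp: set_dealer)
      \<comment> \<open>The repaired player c = l sees components of its own share by
        \<open>comp\<close>, a helper sees its outgoing message, and anyone else sees no
        message.\<close>
      show "W \<sigma> = (\<lambda>x. (restrict (\<lambda>_. x) {c}, \<lambda>_ _. None,
          \<lambda>i. if i \<in> H \<and> (i = c \<or> c = l)
              then Some (enc (triple_component (if c = l then slot i else s (slot i)) x)) else None)) (\<sigma> c)"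
        using comp unfolding W_def coalition_view_def c(1) r
        by (auto simp: exch rep fun_eq_iff restrict_def)
    qed
    then show ?thesis by (simp add: view)
  qed
  have "secure_repairing_protocol 2 n secrets dealer l H P"
    unfolding secure_repairing_protocol_def
  proof (intro conjI ballI allI impI)
    show "finite (exchange_values secrets dealer H P i j)" for i j by (simp add: ex_val)
    show "finite (repair_values secrets dealer H P i)" if "i \<in> H" for i using that fin by (simp add: rep_val)
    show "case x of (\<sigma>, \<rho>) \<Rightarrow> recover P (repair_sent H P \<sigma> \<rho>) = \<sigma> l"
      if "x \<in> executions secrets dealer H P" for x
      using that recover by (cases x) simp
  next
    fix C \<kappa> \<kappa>' assume "C \<subseteq> {1..n} \<and> card C = 2 - 1" and \<kappa>: "\<kappa> \<in> secrets" "\<kappa>' \<in> secrets"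
    then have "C \<subseteq> {1..n}" "card C = 1" by simp_all
    then show "map_pmf (coalition_view l H P C) (execution H P (dealer \<kappa>)) =
        map_pmf (coalition_view l H P C) (execution H P (dealer \<kappa>'))"
      using \<kappa> by (rule privacy)
  qed
  moreover have "communication_complexity secrets dealer H P = 3 / 2"
  proof -
    have "card ((Some \<circ> enc) ` carrier R) = card (carrier R)"
      using enc by (intro card_image comp_inj_on) auto
    then show ?thesis
      using log_card_carrier unfolding communication_complexity_def
      by (simp add: ex_val rep_val H card_secrets log_mult)
  qed
  ultimately show ?thesis using H by blast
qed

lemma restricted_rts_exists:
  "\<exists>(K :: nat set) D H (P :: nat \<Rightarrow> ('a \<times> 'a \<times> 'a, nat, nat) repair_protocol).
     restricted_rts 2 n 3 K triples D H P \<and> information_rate K triples = 2 / 3 \<and>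
     (\<forall>l\<in>{1..n}. communication_complexity K D (H l) (P l) = 3 / 2)"
proof -
  from repairing_protocol_exists obtain H and P :: "nat \<Rightarrow> ('a \<times> 'a \<times> 'a, nat, nat) repair_protocol"
    where "\<And>l. l \<in> {1..n} \<Longrightarrow> H l \<subseteq> {1..n} - {l} \<and> card (H l) = 3 \<and>
      secure_repairing_protocol 2 n secrets dealer l (H l) (P l) \<and>
      communication_complexity secrets dealer (H l) (P l) = 3 / 2"
    by metis
  then have "restricted_rts 2 n 3 secrets triples dealer H P"
    "\<forall>l\<in>{1..n}. communication_complexity secrets dealer (H l) (P l) = 3 / 2"
    using threshold_scheme by (auto simp: restricted_rts_def)
  then show ?thesis using information_rate by blast
qed

end

section \<open>Numbering the blocks by players, and the theorem\<close>

lemma block_enumeration_exists: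
  assumes \<C>: "finite \<C>" "card \<C> = n" "\<And>b. b \<in> \<C> \<Longrightarrow> card b = 3"
  obtains pt :: "nat \<Rightarrow> nat \<Rightarrow> 'a" where "inj_on (\<lambda>i. pt i ` {..<3}) {1..n}"
    "(\<lambda>i. pt i ` {..<3}) ` {1..n} = \<C>" "\<And>i. i \<in> {1..n} \<Longrightarrow> inj_on (pt i) {..<3}"
proof -
  obtain B where B: "bij_betw B {1..n} \<C>" using ex_bij_betw_nat_finite_1[OF \<C>(1)] \<C>(2) by blast
  have "\<exists>f. bij_betw f {..<3::nat} (B i)" if "i \<in> {1..n}" for i
  proof -
    have "card (B i) = 3" using that B \<C>(3) by (auto simp: bij_betw_def)
    moreover from this have "finite (B i)" by (metis card.infinite zero_neq_numeral)
    ultimately show ?thesis using ex_bij_betw_nat_finite[of "B i"] by (simp add: atLeast0LessThan)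
  qed
  then obtain pt where pt: "\<And>i. i \<in> {1..n} \<Longrightarrow> bij_betw (pt i) {..<3::nat} (B i)" by metis
  then have pt_B: "pt i ` {..<3} = B i" if "i \<in> {1..n}" for i using that by (simp add: bij_betw_def)
  show ?thesis
  proof (rule that)
    show "inj_on (\<lambda>i. pt i ` {..<3}) {1..n}"
      using B pt_B inj_on_cong[of "{1..n}" B "\<lambda>i. pt i ` {..<3}"] by (simp add: bij_betw_def)
    show "(\<lambda>i. pt i ` {..<3}) ` {1..n} = \<C>"
      using B pt_B image_cong[of "{1..n}" "{1..n}" B "\<lambda>i. pt i ` {..<3}"] by (simp add: bij_betw_def)
    show "inj_on (pt i) {..<3}" if "i \<in> {1..n}" for i
      using pt[OF that] by (simp add: bij_betw_def)
  qed
qed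

theorem theorem5p1:
  fixes m n Q :: nat and F :: "('a, 'b) ring_scheme"
  assumes "m > 0" and "m mod 6 = 3"
    and "primepow Q" and "Q \<ge> m + 1"
    and "field F" and "finite (carrier F)" and "card (carrier F) = Q"
    and "2 * real m / 3 \<le> real n" and "real n \<le> real m * (real m - 1) / 6"
  shows "\<exists>(K :: nat set) D H (P :: nat \<Rightarrow> ('a \<times> 'a \<times> 'a, nat, nat) repair_protocol).
           restricted_rts 2 n 3 K (carrier F \<times> carrier F \<times> carrier F) D H P \<and>
           information_rate K (carrier F \<times> carrier F \<times> carrier F) = 2 / 3 \<and>
           (\<forall>l\<in>{1..n}. communication_complexity K D (H l) (P l) = 3 / 2)"
proof -
  have "real (2 * m) \<le> real (3 * n)" using assms(8) by simp
  then have n1: "2 * m \<le> 3 * n" by (simp only: of_nat_le_iff)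
  have "real (6 * n) \<le> real (m * (m - 1))" using assms(1,9) by (simp add: of_nat_diff)
  then have n2: "6 * n \<le> m * (m - 1)" by (simp only: of_nat_le_iff)
  have "m \<ge> 3" using assms(2) mod_less_eq_dividend[of m 6] by simp
  then have n: "2 \<le> n" using n1 by simp
  obtain V :: "(int \<times> nat) set" and \<C> where V: "card V = m" "finite V"
    and \<C>: "partial_triple_system V \<C>" "doubly_covering V \<C>" "finite \<C>" "card \<C> = n"
    using doubly_covering_triples_exist[OF assms(2) n1 n2] by blast
  have "card V \<le> card (carrier F)" using V assms(4,7) by simp
  \<comment> \<open>The points become field elements, at which the dealer's polynomial can be
    evaluated.\<close>
  then obtain g where g: "g ` V \<subseteq> carrier F" "inj_on g V"
    using card_le_inj[OF V(2) assms(6)] by metis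
  define \<D> where "\<D> = image g ` \<C>"
  have pow: "\<C> \<subseteq> Pow V" using \<C>(1) by (auto simp: partial_triple_system_def)
  have \<D>: "partial_triple_system (g ` V) \<D>" "doubly_covering (g ` V) \<D>" "finite \<D>"
    unfolding \<D>_def using \<C> partial_triple_system_image[OF g(2)] doubly_covering_image[OF g(2) pow] by auto
  \<comment> \<open>Distinct blocks keep distinct images, so there are still n of them.\<close>
  have "inj_on (image g) \<C>" using inj_on_image_Pow[OF g(2)] pow by (rule inj_on_subset)
  then have card_\<D>: "card \<D> = n" unfolding \<D>_def using \<C>(4) by (simp add: card_image)
  have card_3: "card b = 3" if "b \<in> \<D>" for b
    using that \<D>(1) by (auto simp: partial_triple_system_def)
  obtain pt :: "nat \<Rightarrow> nat \<Rightarrow> 'a" where pt: "inj_on (\<lambda>i. pt i ` {..<3}) {1..n}"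
    "(\<lambda>i. pt i ` {..<3}) ` {1..n} = \<D>" "\<And>i. i \<in> {1..n} \<Longrightarrow> inj_on (pt i) {..<3}"
    using block_enumeration_exists[OF \<D>(3) card_\<D> card_3] by metis
  interpret field F by fact
  interpret block_ramp_scheme F n pt
  proof
    show "finite (carrier F)" "2 \<le> n" by fact+
    fix i assume i: "i \<in> {1..n}"
    then have blk: "pt i ` {..<3} \<in> \<D>" using pt(2) by blast
    show "inj_on (pt i) {..<3}" by (rule pt(3)[OF i])
    have sub: "pt i ` {..<3} \<subseteq> g ` V" using blk \<D>(1) by (auto simp: partial_triple_system_def)
    then show "pt i ` {..<3} \<subseteq> carrier F" using g(1) by blast
    show "card (pt i ` {..<3} \<inter> pt i' ` {..<3}) \<le> 1" if "i' \<in> {1..n}" "i \<noteq> i'" for i'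
    proof -
      have "pt i' ` {..<3} \<in> \<D>" "pt i ` {..<3} \<noteq> pt i' ` {..<3}"
        using that i pt(2) inj_onD[OF pt(1), of i i'] by auto
      then show ?thesis using blk \<D>(1) by (auto simp: partial_triple_system_def pairwise_def)
    qed
    show "\<exists>i'\<in>{1..n} - {i}. pt i j \<in> pt i' ` {..<3}" if "j < 3" for j
    proof -
      have "pt i j \<in> g ` V" using sub that by auto
      \<comment> \<open>Of two distinct blocks through the point, at least one is not the block of
        player i.\<close>
      then obtain b where "b \<in> \<D>" "b \<noteq> pt i ` {..<3}" "pt i j \<in> b"
        using \<D>(2) unfolding doubly_covering_def by metis
      then show ?thesis using pt(2) by blast
    qed
  qed
  show ?thesis by (rule restricted_rts_exists)
qed

end
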